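(* Let $R=(R_t)_{t=0}^T$ be a real-valued adapted process and consider the optimal stopping problem $$(OS)\qquad\text{maximize } ER_\tau\ \text{ over }\tau\in\mathcal T,$$ the relaxed problem $$(ROS)\qquad\text{maximize } E\sum_{t=0}^TR_tx_t\ \text{ over }x\in\mathcal N\ \text{ subject to } x\ge0,\ \sum_{t=0}^Tx_t\le1\ \text{a.s.}$$ and the dual problem $$(D_{OS})\qquad\text{minimize } Ey\ \text{ over }(p,y)\in\mathcal X_a^\perp\times\mathcal Y_+\ \text{ subject to } p_t+R_t\le y,\ t=0,\dots,T\ \text{a.s.}$$ If $\max_{t}R_t\in\mathcal Y$, then the following are equivalent: 1. $x$ solves $(ROS)$, $(p,y)$ solves $(D_{OS})$ and there is no duality gap (i.e. $\sup(ROS)=\inf(D_{OS})$); 2. $x\in\mathcal X_a$, $(p,y)\in\mathcal X_a^\perp\times\mathcal Y$ and, almost surely, $$x_t\ge0,\quad p_t+R_t\le y,\quad x_t(p_t+R_t-y)=0,\quad t=0,\dots,T,$$ $$y\ge0,\quad \sum_{t=0}^Tx_t\le1,\quad y\Big(\sum_{t=0}^Tx_t-1\Big)=0.$$ In particular, a stopping time $\tau\in\mathcal T$ is optimal in $(OS)$ and $(p,y)\in\mathcal X_a^\perp\times\mathcal Y_+$ solves $(D_{OS})$ if and only if $p_t+R_t\le y$ for all $t=0,\dots,T$ and $p_\tau+R_\tau=y$ almost surely.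
   Context: $(\Omega,\mathcal F,P)$ is a probability space with a filtration $(\mathcal F_t)_{t=0}^T$ (an increasing sequence of sub-$\sigma$-algebras of $\mathcal F$). $\mathcal N$ is the linear space of all real-valued processes $x=(x_t)_{t=0}^T$ (elements of $L^0(\mathbb R^{T+1})$) with $x_t$ $\mathcal F_t$-measurable for every $t$. Random variables equal a.s. are identified. $\mathcal T$ is the set of stopping times: measurable $\tau:\Omega\to\{0,\dots,T+1\}$ with $\{\tau\le t\}\in\mathcal F_t$ for $t=0,\dots,T$. $\tau=T+1$ means not stopping at all, with the conventions $R_{T+1}:=0$ and $p_{T+1}:=0$. In the maximization problems, the expectation of an extended real-valued random variable is $-\infty$ unless its negative part is integrable. A linear space $\mathcal U$ of $\mathbb R^k$-valued random variables is decomposable if $1_Au+1_{\Omega\setminus A}u'\in\mathcal U$ for all $u\in\mathcal U$, $u'\in L^\infty$, $A\in\mathcal F$; it is solid if $\bar u\in\mathcal U$, $u\in L^0$ and $|u^i|\le|\bar u^i|$ a.s. for all components $i$ imply $u\in\mathcal U$. $\mathcal X,\mathcal V$ are solid decomposable spaces of $\mathbb R^{T+1}$-valued random variables in separating duality under $\langle x,v\rangle:=E[x\cdot v]$, and $\mathcal U,\mathcal Y$ are solid decomposable spaces of real-valued random variables in separating duality under $\langle u,y\rangle:=E[uy]$ (in particular $L^\infty\subseteq\mathcal Y\subseteq L^1$). $\mathcal Y_+:=\{y\in\mathcal Y: y\ge0\text{ a.s.}\}$. $\mathcal X_a:=\mathcal X\cap\mathcal N$ and $\mathcal X_a^\perp:=\{v\in\mathcal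 V:\langle x,v\rangle=0\ \forall x\in\mathcal X_a\}$. "Solves"/"optimal" means satisfying the constraints, with finite objective value, and attaining the optimum value. *)

theory Defs
  imports "HOL-Probability.Probability"
begin

text \<open>
  An \<open>\<real>\<^sup>k\<close>-valued random variable is a function \<open>u :: nat \<Rightarrow> 'a \<Rightarrow> real\<close> of which only the components
  \<open>u i\<close> with \<open>i < k\<close> are meaningful. Random variables are not quotiented by almost sure equality;
  instead, every space of random variables below is closed under it (for solid spaces this follows
  from solidity), and under changing the components with \<open>i \<ge> k\<close>.
\<close>

definition L0 :: "'a measure \<Rightarrow> nat \<Rightarrow> (nat \<Rightarrow> 'a \<Rightarrow> real) set" where
  "L0 M k = {u. \<forall>i<k. u i \<in> borel_measurable M}"

definition Linf :: "'a measure \<Rightarrow> nat \<Rightarrow> (nat \<Rightarrow> 'a \<Rightarrow> real) set" where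
  "Linf M k = {u \<in> L0 M k. \<exists>C. \<forall>i<k. AE \<omega> in M. \<bar>u i \<omega>\<bar> \<le> C}"

definition linear_space :: "'a measure \<Rightarrow> nat \<Rightarrow> (nat \<Rightarrow> 'a \<Rightarrow> real) set \<Rightarrow> bool" where
  "linear_space M k U \<longleftrightarrow> U \<subseteq> L0 M k \<and> (\<lambda>i \<omega>. 0) \<in> U \<and>
     (\<forall>u\<in>U. \<forall>u'\<in>U. (\<lambda>i \<omega>. u i \<omega> + u' i \<omega>) \<in> U) \<and>
     (\<forall>c. \<forall>u\<in>U. (\<lambda>i \<omega>. c * u i \<omega>) \<in> U)"

definition decomposable :: "'a measure \<Rightarrow> nat \<Rightarrow> (nat \<Rightarrow> 'a \<Rightarrow> real) set \<Rightarrow> bool" where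
  "decomposable M k U \<longleftrightarrow> (\<forall>u\<in>U. \<forall>u'\<in>Linf M k. \<forall>A\<in>sets M.
     (\<lambda>i \<omega>. indicator A \<omega> * u i \<omega> + indicator (space M - A) \<omega> * u' i \<omega>) \<in> U)"

definition solid :: "'a measure \<Rightarrow> nat \<Rightarrow> (nat \<Rightarrow> 'a \<Rightarrow> real) set \<Rightarrow> bool" where
  "solid M k U \<longleftrightarrow> (\<forall>ubar\<in>U. \<forall>u\<in>L0 M k.
     (\<forall>i<k. AE \<omega> in M. \<bar>u i \<omega>\<bar> \<le> \<bar>ubar i \<omega>\<bar>) \<longrightarrow> u \<in> U)"

definition pairing :: "'a measure \<Rightarrow> nat \<Rightarrow> (nat \<Rightarrow> 'a \<Rightarrow> real) \<Rightarrow> (nat \<Rightarrow> 'a \<Rightarrow> real) \<Rightarrow> real" where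
  "pairing M k u v = (\<integral>\<omega>. (\<Sum>i<k. u i \<omega> * v i \<omega>) \<partial>M)"

text \<open>
  The integrability clause makes the bilinear form well defined and finite on \<open>U \<times> V\<close>.
\<close>

definition separating_duality ::
  "'a measure \<Rightarrow> nat \<Rightarrow> (nat \<Rightarrow> 'a \<Rightarrow> real) set \<Rightarrow> (nat \<Rightarrow> 'a \<Rightarrow> real) set \<Rightarrow> bool" where
  "separating_duality M k U V \<longleftrightarrow>
     (\<forall>u\<in>U. \<forall>v\<in>V. integrable M (\<lambda>\<omega>. \<Sum>i<k. u i \<omega> * v i \<omega>)) \<and>
     (\<forall>u\<in>U. (\<forall>v\<in>V. pairing M k u v = 0) \<longrightarrow> (\<forall>i<k. AE \<omega> in M. u i \<omega> = 0)) \<and>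
     (\<forall>v\<in>V. (\<forall>u\<in>U. pairing M k u v = 0) \<longrightarrow> (\<forall>i<k. AE \<omega> in M. v i \<omega> = 0))"

definition dual_pair ::
  "'a measure \<Rightarrow> nat \<Rightarrow> (nat \<Rightarrow> 'a \<Rightarrow> real) set \<Rightarrow> (nat \<Rightarrow> 'a \<Rightarrow> real) set \<Rightarrow> bool" where
  "dual_pair M k U V \<longleftrightarrow>
     linear_space M k U \<and> decomposable M k U \<and> solid M k U \<and>
     linear_space M k V \<and> decomposable M k V \<and> solid M k V \<and>
     separating_duality M k U V"

text \<open>
  Spaces of real-valued random variables are the case \<open>k = 1\<close>, with \<open>u\<close> in the role of the only
  component.
\<close>

definition scalar_dual_pair :: "'a measure \<Rightarrow> ('a \<Rightarrow> real) set \<Rightarrow> ('a \<Rightarrow> real) set \<Rightarrow> bool" where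
  "scalar_dual_pair M U Y \<longleftrightarrow> dual_pair M 1 {u. u 0 \<in> U} {y. y 0 \<in> Y}"

definition filtration_upto :: "'a measure \<Rightarrow> nat \<Rightarrow> (nat \<Rightarrow> 'a measure) \<Rightarrow> bool" where
  "filtration_upto M T F \<longleftrightarrow> (\<forall>t\<le>T. subalgebra M (F t)) \<and>
     (\<forall>s t. s \<le> t \<longrightarrow> t \<le> T \<longrightarrow> sets (F s) \<subseteq> sets (F t))"

text \<open>
  Since random variables are identified when they are equal almost surely, a process belongs to
  \<open>\<N>\<close> as soon as each \<open>x\<^sub>t\<close> has an \<open>\<F>\<^sub>t\<close>-measurable version.
\<close>

definition adapted_processes ::
  "'a measure \<Rightarrow> nat \<Rightarrow> (nat \<Rightarrow> 'a measure) \<Rightarrow> (nat \<Rightarrow> 'a \<Rightarrow> real) set" where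
  "adapted_processes M T F = {x \<in> L0 M (Suc T).
     \<forall>t\<le>T. \<exists>x'\<in>borel_measurable (F t). AE \<omega> in M. x t \<omega> = x' \<omega>}"

definition stopping_times :: "'a measure \<Rightarrow> nat \<Rightarrow> (nat \<Rightarrow> 'a measure) \<Rightarrow> ('a \<Rightarrow> nat) set" where
  "stopping_times M T F = {\<tau> \<in> measurable M (count_space {0..T+1}).
     \<forall>t\<le>T. {\<omega> \<in> space M. \<tau> \<omega> \<le> t} \<in> sets (F t)}"

text \<open>The random variable \<open>z\<^sub>\<tau>\<close>, with the convention \<open>z\<^bsub>T+1\<^esub> = 0\<close>.\<close>

definition stopped :: "nat \<Rightarrow> (nat \<Rightarrow> 'a \<Rightarrow> real) \<Rightarrow> ('a \<Rightarrow> nat) \<Rightarrow> 'a \<Rightarrow> real" where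
  "stopped T z \<tau> \<omega> = (if \<tau> \<omega> \<le> T then z (\<tau> \<omega>) \<omega> else 0)"

text \<open>
  Extended-valued expectation, equal to \<open>-\<infinity>\<close> unless the negative part is integrable. Note that
  \<open>ennreal\<close> truncates negative reals to \<open>0\<close>, so the two integrals are those of the positive and
  the negative part.
\<close>

definition upper_expectation :: "'a measure \<Rightarrow> ('a \<Rightarrow> real) \<Rightarrow> ereal" where
  "upper_expectation M f =
     (if (\<integral>\<^sup>+\<omega>. ennreal (- f \<omega>) \<partial>M) = \<infinity> then -\<infinity>
      else enn2ereal (\<integral>\<^sup>+\<omega>. ennreal (f \<omega>) \<partial>M) - enn2ereal (\<integral>\<^sup>+\<omega>. ennreal (- f \<omega>) \<partial>M))"

definition solves_max :: "'b set \<Rightarrow> ('b \<Rightarrow> ereal) \<Rightarrow> 'b \<Rightarrow> bool" where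
  "solves_max S f z \<longleftrightarrow> z \<in> S \<and> \<bar>f z\<bar> \<noteq> \<infinity> \<and> f z = (SUP w\<in>S. f w)"

definition solves_min :: "'b set \<Rightarrow> ('b \<Rightarrow> ereal) \<Rightarrow> 'b \<Rightarrow> bool" where
  "solves_min S f z \<longleftrightarrow> z \<in> S \<and> \<bar>f z\<bar> \<noteq> \<infinity> \<and> f z = (INF w\<in>S. f w)"

definition OS_value :: "'a measure \<Rightarrow> nat \<Rightarrow> (nat \<Rightarrow> 'a \<Rightarrow> real) \<Rightarrow> ('a \<Rightarrow> nat) \<Rightarrow> ereal" where
  "OS_value M T R \<tau> = upper_expectation M (stopped T R \<tau>)"

definition ROS_feasible ::
  "'a measure \<Rightarrow> nat \<Rightarrow> (nat \<Rightarrow> 'a measure) \<Rightarrow> (nat \<Rightarrow> 'a \<Rightarrow> real) set" where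
  "ROS_feasible M T F = {x \<in> adapted_processes M T F.
     (AE \<omega> in M. (\<forall>t\<le>T. 0 \<le> x t \<omega>) \<and> (\<Sum>t\<le>T. x t \<omega>) \<le> 1)}"

definition ROS_value ::
  "'a measure \<Rightarrow> nat \<Rightarrow> (nat \<Rightarrow> 'a \<Rightarrow> real) \<Rightarrow> (nat \<Rightarrow> 'a \<Rightarrow> real) \<Rightarrow> ereal" where
  "ROS_value M T R x = upper_expectation M (\<lambda>\<omega>. \<Sum>t\<le>T. R t \<omega> * x t \<omega>)"

definition adapted_part ::
  "'a measure \<Rightarrow> nat \<Rightarrow> (nat \<Rightarrow> 'a measure) \<Rightarrow> (nat \<Rightarrow> 'a \<Rightarrow> real) set \<Rightarrow> (nat \<Rightarrow> 'a \<Rightarrow> real) set" where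
  "adapted_part M T F X = X \<inter> adapted_processes M T F"

definition annihilator ::
  "'a measure \<Rightarrow> nat \<Rightarrow> (nat \<Rightarrow> 'a \<Rightarrow> real) set \<Rightarrow> (nat \<Rightarrow> 'a \<Rightarrow> real) set \<Rightarrow> (nat \<Rightarrow> 'a \<Rightarrow> real) set" where
  "annihilator M k V Xa = {v \<in> V. \<forall>x\<in>Xa. pairing M k x v = 0}"

abbreviation adapted_perp ::
  "'a measure \<Rightarrow> nat \<Rightarrow> (nat \<Rightarrow> 'a measure) \<Rightarrow> (nat \<Rightarrow> 'a \<Rightarrow> real) set \<Rightarrow> (nat \<Rightarrow> 'a \<Rightarrow> real) set
     \<Rightarrow> (nat \<Rightarrow> 'a \<Rightarrow> real) set" where
  "adapted_perp M T F X V \<equiv> annihilator M (Suc T) V (adapted_part M T F X)"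

definition nonneg_part :: "'a measure \<Rightarrow> ('a \<Rightarrow> real) set \<Rightarrow> ('a \<Rightarrow> real) set" where
  "nonneg_part M Y = {y \<in> Y. AE \<omega> in M. 0 \<le> y \<omega>}"

definition DOS_feasible ::
  "'a measure \<Rightarrow> nat \<Rightarrow> (nat \<Rightarrow> 'a measure) \<Rightarrow> (nat \<Rightarrow> 'a \<Rightarrow> real) \<Rightarrow> (nat \<Rightarrow> 'a \<Rightarrow> real) set
     \<Rightarrow> (nat \<Rightarrow> 'a \<Rightarrow> real) set \<Rightarrow> ('a \<Rightarrow> real) set \<Rightarrow> ((nat \<Rightarrow> 'a \<Rightarrow> real) \<times> ('a \<Rightarrow> real)) set" where
  "DOS_feasible M T F R X V Y = {(p, y). p \<in> adapted_perp M T F X V \<and> y \<in> nonneg_part M Y \<and>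
     (AE \<omega> in M. \<forall>t\<le>T. p t \<omega> + R t \<omega> \<le> y \<omega>)}"

text \<open>
  The Bochner integral is the actual expectation here, because \<open>Y \<subseteq> L\<^sup>1\<close> when \<open>Y\<close> is in duality
  with a decomposable space.
\<close>

definition DOS_value :: "'a measure \<Rightarrow> (nat \<Rightarrow> 'a \<Rightarrow> real) \<times> ('a \<Rightarrow> real) \<Rightarrow> ereal" where
  "DOS_value M = (\<lambda>(p, y). ereal (\<integral>\<omega>. y \<omega> \<partial>M))"

end

(*
  A feasible x is bounded, hence pairs to zero with p in X_a^perp, so that
  E y - E sum_t R_t x_t = E (y - sum_t x_t (p_t + R_t)).  The integrand on the right is nonnegative,
  which gives weak duality, and it vanishes a.s. exactly when complementary slackness holds.
  A stopping time is the relaxed strategy x_t = 1{tau = t}.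

  It remains to see that (OS) and the dual have the same value.  The Snell recursion yields a stopping
  time tau and an integrable pair (p, y) with E[p_t | F_t] = 0, p_t + R_t <= y and E y = E R_tau.
  Replacing p by its truncations at level k, recentred by their conditional expectations, gives
  bounded elements of X_a^perp, and y_k = max(0, max_t (p^k_t + R_t)) lies in Y since max_t R_t does;
  E y_k is at most E y plus a multiple of the L^1 error of the truncation, which tends to zero.
*)

theory Submission
  imports Defs
begin

section \<open>Extended-valued expectations\<close>

lemma upper_expectation_eq_integral:
  assumes "integrable M f"
  shows "upper_expectation M f = ereal (\<integral>\<omega>. f \<omega> \<partial>M)"
proof -
  have fin: "(\<integral>\<^sup>+\<omega>. ennreal (f \<omega>) \<partial>M) \<noteq> \<infinity>" "(\<integral>\<^sup>+\<omega>. ennreal (- f \<omega>) \<partial>M) \<noteq> \<infinity>"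
    using assms by (auto simp: real_integrable_def)
  from fin(1) obtain a where a: "(\<integral>\<^sup>+\<omega>. ennreal (f \<omega>) \<partial>M) = ennreal a" "a \<ge> 0"
    by (cases "\<integral>\<^sup>+\<omega>. ennreal (f \<omega>) \<partial>M") auto
  from fin(2) obtain b where b: "(\<integral>\<^sup>+\<omega>. ennreal (- f \<omega>) \<partial>M) = ennreal b" "b \<ge> 0"
    by (cases "\<integral>\<^sup>+\<omega>. ennreal (- f \<omega>) \<partial>M") auto
  show ?thesis
    using a b by (simp add: upper_expectation_def real_lebesgue_integral_def[OF assms])
qed

text \<open>A non-integrable negative part would give the value -\<infinity>; once it is excluded, a
  finite difference also bounds the positive part. In the weak duality lemma this yields
  integrability of a reward whose expectation equals a dual value.\<close>

lemma integrable_if_upper_expectation_finite: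
  assumes "f \<in> borel_measurable M" "\<bar>upper_expectation M f\<bar> \<noteq> \<infinity>"
  shows "integrable M f"
proof -
  have neg: "(\<integral>\<^sup>+\<omega>. ennreal (- f \<omega>) \<partial>M) \<noteq> \<infinity>"
    using assms(2) by (auto simp: upper_expectation_def)
  then obtain b where b: "(\<integral>\<^sup>+\<omega>. ennreal (- f \<omega>) \<partial>M) = ennreal b" "b \<ge> 0"
    by (cases "\<integral>\<^sup>+\<omega>. ennreal (- f \<omega>) \<partial>M") auto
  have "(\<integral>\<^sup>+\<omega>. ennreal (f \<omega>) \<partial>M) \<noteq> \<infinity>"
    using assms(2) b by (auto simp: upper_expectation_def)
  with neg assms(1) show ?thesis by (simp add: real_integrable_def)
qed

text \<open>The convention for -\<infinity> respects the order: a larger function has a smaller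
  negative part, so \<open>g\<close> can take the value of the first branch only if \<open>f\<close>
  does. Otherwise both negative parts are finite and the two parts are compared separately.\<close>

lemma upper_expectation_mono:
  assumes "AE \<omega> in M. f \<omega> \<le> g \<omega>"
  shows "upper_expectation M f \<le> upper_expectation M g"
proof (cases "(\<integral>\<^sup>+\<omega>. ennreal (- f \<omega>) \<partial>M) = \<infinity>")
  case True
  then show ?thesis by (simp add: upper_expectation_def)
next
  case False
  have neg: "(\<integral>\<^sup>+\<omega>. ennreal (- g \<omega>) \<partial>M) \<le> (\<integral>\<^sup>+\<omega>. ennreal (- f \<omega>) \<partial>M)"
    using assms by (intro nn_integral_mono_AE) (auto intro: ennreal_leI elim!: eventually_mono)
  have pos: "(\<integral>\<^sup>+\<omega>. ennreal (f \<omega>) \<partial>M) \<le> (\<integral>\<^sup>+\<omega>. ennreal (g \<omega>) \<partial>M)"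
    using assms by (intro nn_integral_mono_AE) (auto intro: ennreal_leI elim!: eventually_mono)
  have "(\<integral>\<^sup>+\<omega>. ennreal (- g \<omega>) \<partial>M) \<noteq> \<infinity>"
    using neg False by (auto simp: top_unique)
  with False neg pos show ?thesis
    by (simp add: upper_expectation_def ereal_minus_mono less_eq_ennreal.rep_eq)
qed

lemma upper_expectation_cong_AE:
  assumes "AE \<omega> in M. f \<omega> = g \<omega>"
  shows "upper_expectation M f = upper_expectation M g"
  using assms by (intro antisym upper_expectation_mono) (auto elim: eventually_mono)

section \<open>Solid decomposable spaces in duality\<close>

lemma pairing_commute: "pairing M k u v = pairing M k v u"
  unfolding pairing_def by (simp only: mult.commute)

lemma dual_pair_integrable_pairing:
  assumes "dual_pair M k U V" "u \<in> U" "v \<in> V"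
  shows "integrable M (\<lambda>\<omega>. \<Sum>i<k. u i \<omega> * v i \<omega>)"
  using assms by (simp add: dual_pair_def separating_duality_def)

lemma dual_pair_swap:
  assumes "dual_pair M k U V"
  shows "dual_pair M k V U"
proof -
  have "integrable M (\<lambda>\<omega>. \<Sum>i<k. v i \<omega> * u i \<omega>)" if "u \<in> U" "v \<in> V" for u v
    using dual_pair_integrable_pairing[OF assms that] by (simp only: mult.commute)
  with assms show ?thesis
    unfolding dual_pair_def separating_duality_def
    by (simp add: pairing_commute[of M k _ "_ :: nat \<Rightarrow> 'a \<Rightarrow> real"])
qed

lemma dual_pair_memD:
  assumes "dual_pair M k U V" "u \<in> U" "i < k"
  shows "u i \<in> borel_measurable M"
  using assms by (auto simp: dual_pair_def linear_space_def L0_def)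

lemma dual_pair_solidD:
  assumes "dual_pair M k U V" "v \<in> U" "u \<in> L0 M k" "\<And>i. i < k \<Longrightarrow> AE \<omega> in M. \<bar>u i \<omega>\<bar> \<le> \<bar>v i \<omega>\<bar>"
  shows "u \<in> U"
  using assms unfolding dual_pair_def solid_def by blast

text \<open>Decomposability is applied to the zero element with the empty set, which leaves only the
  bounded function.\<close>

lemma dual_pair_Linf_subset:
  assumes "dual_pair M k U V"
  shows "Linf M k \<subseteq> U"
proof
  fix u assume u: "u \<in> Linf M k"
  have 0: "(\<lambda>i \<omega>. 0) \<in> U"
    using assms by (auto simp: dual_pair_def linear_space_def)
  have "(\<lambda>i \<omega>. indicator {} \<omega> * (0::real) + indicator (space M - {}) \<omega> * u i \<omega>) \<in> U"
    using assms u 0 sets.empty_sets[of M] unfolding dual_pair_def decomposable_def by fast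
  \<comment> \<open>The element obtained agrees with \<open>u\<close> on \<open>space M\<close>
    only, because the indicator vanishes outside; solidity absorbs this difference.\<close>
  then show "u \<in> U"
    by (rule dual_pair_solidD[OF assms]) (use u in \<open>auto simp: Linf_def\<close>)
qed

lemma dual_pair_const:
  assumes "dual_pair M k U V"
  shows "(\<lambda>_ _. c) \<in> U"
proof -
  have "(\<lambda>_ _. c) \<in> Linf M k" by (auto simp: Linf_def L0_def)
  with dual_pair_Linf_subset[OF assms] show ?thesis by blast
qed

text \<open>Duality makes only the full sum of products integrable. By solidity all components of
  \<open>v\<close> except the \<open>i\<close>-th may be set to zero, and the sum then reduces to a
  single product.\<close>

lemma dual_pair_integrable_mult:
  assumes D: "dual_pair M k U V" and u: "u \<in> U" and v: "v \<in> V" and i: "i < k"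
  shows "integrable M (\<lambda>\<omega>. u i \<omega> * v i \<omega>)"
proof -
  let ?w = "\<lambda>j \<omega>. if j = i then v i \<omega> else 0"
  note D' = dual_pair_swap[OF D]
  have "?w \<in> V"
    by (rule dual_pair_solidD[OF D' v]) (use dual_pair_memD[OF D' v i] in \<open>auto simp: L0_def\<close>)
  then have "integrable M (\<lambda>\<omega>. \<Sum>j<k. u j \<omega> * ?w j \<omega>)"
    by (rule dual_pair_integrable_pairing[OF D u])
  moreover have "(\<Sum>j<k. u j \<omega> * ?w j \<omega>) = u i \<omega> * v i \<omega>" for \<omega>
  proof -
    have "(\<Sum>j<k. u j \<omega> * ?w j \<omega>) = (\<Sum>j<k. if j = i then u j \<omega> * v j \<omega> else 0)"
      by (intro sum.cong) auto
    with i show ?thesis by simp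
  qed
  ultimately show ?thesis by simp
qed

lemma dual_pair_integrable:
  assumes D: "dual_pair M k U V" and u: "u \<in> U" and i: "i < k"
  shows "integrable M (u i)"
proof -
  have "(\<lambda>_ _. 1) \<in> V"
    by (rule dual_pair_const[OF dual_pair_swap[OF D]])
  from dual_pair_integrable_mult[OF D u this i] show ?thesis by simp
qed

lemma scalar_dual_pair_integrable:
  assumes "scalar_dual_pair M U Y" "y \<in> Y"
  shows "integrable M y"
proof -
  have "dual_pair M 1 {y. y 0 \<in> Y} {u. u 0 \<in> U}"
    using assms(1) by (simp only: scalar_dual_pair_def dual_pair_swap)
  from dual_pair_integrable[OF this, of "\<lambda>_. y" 0] assms(2) show ?thesis by simp
qed

text \<open>Solidity puts \<bar>z\<bar> into \<open>Y\<close>, decomposability supplies the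
  constants, and linearity their sum, which dominates \<open>y\<close>. This transfers membership in
  \<open>Y\<close> from the maximal reward to its bounded perturbations.\<close>

lemma scalar_dual_pair_abs_le_add_const:
  assumes D: "scalar_dual_pair M U Y" and z: "z \<in> Y" and y: "y \<in> borel_measurable M"
    and le: "AE \<omega> in M. \<bar>y \<omega>\<bar> \<le> \<bar>z \<omega>\<bar> + c"
  shows "y \<in> Y"
proof -
  have D': "dual_pair M 1 {y. y 0 \<in> Y} {u. u 0 \<in> U}"
    using D by (simp only: scalar_dual_pair_def dual_pair_swap)
  have zm: "z \<in> borel_measurable M"
    using dual_pair_memD[OF D', of "\<lambda>_. z" 0] z by simp
  have "(\<lambda>i::nat. \<lambda>\<omega>. \<bar>z \<omega>\<bar>) \<in> {y. y 0 \<in> Y}"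
    by (rule dual_pair_solidD[OF D', of "\<lambda>_. z"]) (use z zm in \<open>auto simp: L0_def\<close>)
  moreover have "(\<lambda>i::nat. \<lambda>\<omega>. c) \<in> {y. y 0 \<in> Y}"
    by (rule dual_pair_const[OF D'])
  ultimately have "(\<lambda>i::nat. \<lambda>\<omega>. \<bar>z \<omega>\<bar> + c) \<in> {y. y 0 \<in> Y}"
    using D' unfolding dual_pair_def linear_space_def by fast
  then have "(\<lambda>i::nat. y) \<in> {y. y 0 \<in> Y}"
    by (rule dual_pair_solidD[OF D']) (use y le in \<open>auto simp: L0_def elim!: eventually_mono\<close>)
  then show ?thesis by simp
qed

section \<open>Weak duality and complementary slackness\<close>

lemma adapted_perp_integral:
  assumes D: "dual_pair M (Suc T) X V" and x: "x \<in> adapted_part M T F X"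
    and p: "p \<in> adapted_perp M T F X V"
  shows "integrable M (\<lambda>\<omega>. \<Sum>t\<le>T. x t \<omega> * p t \<omega>)" "(\<integral>\<omega>. (\<Sum>t\<le>T. x t \<omega> * p t \<omega>) \<partial>M) = 0"
proof -
  have "x \<in> X" "p \<in> V" using x p by (auto simp: adapted_part_def annihilator_def)
  with D have "integrable M (\<lambda>\<omega>. \<Sum>t<Suc T. x t \<omega> * p t \<omega>)"
    by (rule dual_pair_integrable_pairing)
  then show "integrable M (\<lambda>\<omega>. \<Sum>t\<le>T. x t \<omega> * p t \<omega>)"
    by (simp only: lessThan_Suc_atMost)
  show "(\<integral>\<omega>. (\<Sum>t\<le>T. x t \<omega> * p t \<omega>) \<partial>M) = 0"
    using x p by (auto simp: annihilator_def pairing_def lessThan_Suc_atMost)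
qed

text \<open>Nonnegative components with sum at most 1 lie in [0,1], and bounded processes belong to
  every admissible \<open>X\<close>. So relaxed strategies can be paired with
  \<open>adapted_perp\<close> even though (ROS) does not mention \<open>X\<close>.\<close>

lemma ROS_feasible_subset_adapted_part:
  assumes D: "dual_pair M (Suc T) X V"
  shows "ROS_feasible M T F \<subseteq> adapted_part M T F X"
proof
  fix x assume x: "x \<in> ROS_feasible M T F"
  have x01: "AE \<omega> in M. \<forall>t\<le>T. \<bar>x t \<omega>\<bar> \<le> 1"
    using x unfolding ROS_feasible_def
  proof (clarify, eventually_elim, clarify)
    fix \<omega> t assume h: "\<forall>t\<le>T. 0 \<le> x t \<omega>" "(\<Sum>t\<le>T. x t \<omega>) \<le> 1" "t \<le> T"
    then have "x t \<omega> \<le> (\<Sum>t\<le>T. x t \<omega>)" by (intro member_le_sum) auto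
    with h show "\<bar>x t \<omega>\<bar> \<le> 1" by auto
  qed
  have "x \<in> Linf M (Suc T)"
    unfolding Linf_def
  proof (intro CollectI conjI exI[of _ 1] allI impI)
    show "x \<in> L0 M (Suc T)"
      using x by (simp add: ROS_feasible_def adapted_processes_def)
    show "AE \<omega> in M. \<bar>x i \<omega>\<bar> \<le> 1" if "i < Suc T" for i
      using x01 that by (auto elim!: eventually_mono)
  qed
  with dual_pair_Linf_subset[OF D] x show "x \<in> adapted_part M T F X"
    by (auto simp: adapted_part_def ROS_feasible_def)
qed

text \<open>The estimate passes through the sum of x_t y. The first gap is the sum of the
  nonnegative terms x_t (y - q_t), the second is y times (1 - sum of x_t); equality of the two ends
  forces both gaps to vanish, and the first one term by term.\<close>

lemma slackness_nonneg:
  fixes x q :: "nat \<Rightarrow> real"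
  assumes "\<forall>t\<le>T. 0 \<le> x t" "\<forall>t\<le>T. q t \<le> y" "(\<Sum>t\<le>T. x t) \<le> 1" "0 \<le> y"
  shows "(\<Sum>t\<le>T. x t * q t) \<le> y"
    and "(\<Sum>t\<le>T. x t * q t) = y \<Longrightarrow>
      (\<forall>t\<le>T. x t * (q t - y) = 0) \<and> y * ((\<Sum>t\<le>T. x t) - 1) = 0"
proof -
  have le: "(\<Sum>t\<le>T. x t * q t) \<le> (\<Sum>t\<le>T. x t * y)"
    using assms by (intro sum_mono mult_left_mono) auto
  have le': "(\<Sum>t\<le>T. x t * y) \<le> y"
    using mult_right_mono[OF assms(3,4)] by (simp add: sum_distrib_right)
  show "(\<Sum>t\<le>T. x t * q t) \<le> y" using le le' by simp
  assume eq: "(\<Sum>t\<le>T. x t * q t) = y"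
  with le le' have xy: "(\<Sum>t\<le>T. x t * y) = y" by simp
  with eq have "(\<Sum>t\<le>T. x t * (y - q t)) = 0"
    by (simp add: right_diff_distrib sum_subtractf)
  moreover have "\<forall>t\<in>{..T}. 0 \<le> x t * (y - q t)" using assms by auto
  ultimately have "\<forall>t\<in>{..T}. x t * (y - q t) = 0"
    by (subst (asm) sum_nonneg_eq_0_iff) auto
  moreover have "y * ((\<Sum>t\<le>T. x t) - 1) = 0"
    using xy by (simp add: right_diff_distrib sum_distrib_left mult.commute)
  ultimately show "(\<forall>t\<le>T. x t * (q t - y) = 0) \<and> y * ((\<Sum>t\<le>T. x t) - 1) = 0"
    by auto
qed

lemma ROS_DOS_weak_duality:
  assumes D: "dual_pair M (Suc T) X V" and D': "scalar_dual_pair M U Y"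
    and R: "R \<in> adapted_processes M T F"
    and x: "x \<in> ROS_feasible M T F" and d: "(p, y) \<in> DOS_feasible M T F R X V Y"
  shows "ROS_value M T R x \<le> DOS_value M (p, y)"
    and "ROS_value M T R x = DOS_value M (p, y) \<longleftrightarrow>
      (AE \<omega> in M. (\<Sum>t\<le>T. x t \<omega> * (p t \<omega> + R t \<omega>)) = y \<omega>)"
proof -
  have xa: "x \<in> adapted_part M T F X"
    using ROS_feasible_subset_adapted_part[OF D] x by blast
  have p: "p \<in> adapted_perp M T F X V" and y: "y \<in> Y" and y0: "AE \<omega> in M. 0 \<le> y \<omega>"
    and pRy: "AE \<omega> in M. \<forall>t\<le>T. p t \<omega> + R t \<omega> \<le> y \<omega>"
    using d by (auto simp: DOS_feasible_def nonneg_part_def)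
  note xp = adapted_perp_integral[OF D xa p]
  have yi: "integrable M y" using scalar_dual_pair_integrable[OF D' y] .
  have x01: "AE \<omega> in M. (\<forall>t\<le>T. 0 \<le> x t \<omega>) \<and> (\<Sum>t\<le>T. x t \<omega>) \<le> 1"
    using x by (simp add: ROS_feasible_def)
  have [measurable]: "x t \<in> borel_measurable M" "R t \<in> borel_measurable M" if "t \<le> T" for t
    using x R that by (auto simp: ROS_feasible_def adapted_processes_def L0_def)
  define f where "f = (\<lambda>\<omega>. \<Sum>t\<le>T. R t \<omega> * x t \<omega>)"
  define g where "g = (\<lambda>\<omega>. y \<omega> - (\<Sum>t\<le>T. x t \<omega> * p t \<omega>))"
  have fm: "f \<in> borel_measurable M" unfolding f_def by measurable
  have g: "integrable M g" "(\<integral>\<omega>. g \<omega> \<partial>M) = (\<integral>\<omega>. y \<omega> \<partial>M)"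
    using yi xp by (auto simp: g_def)
  have split: "(\<Sum>t\<le>T. x t \<omega> * (p t \<omega> + R t \<omega>)) = y \<omega> \<longleftrightarrow> f \<omega> = g \<omega>" for \<omega>
    by (auto simp: f_def g_def distrib_left sum.distrib mult.commute)
  have fg: "AE \<omega> in M. f \<omega> \<le> g \<omega>"
    using x01 y0 pRy
  proof eventually_elim
    case (elim \<omega>)
    then have "(\<Sum>t\<le>T. x t \<omega> * (p t \<omega> + R t \<omega>)) \<le> y \<omega>"
      by (intro slackness_nonneg(1)) auto
    then show ?case
      by (simp add: f_def g_def distrib_left sum.distrib mult.commute)
  qed
  have dv: "DOS_value M (p, y) = ereal (\<integral>\<omega>. g \<omega> \<partial>M)"
    using g by (simp add: DOS_value_def)
  have rv: "ROS_value M T R x = upper_expectation M f"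
    by (simp add: ROS_value_def f_def)
  show "ROS_value M T R x \<le> DOS_value M (p, y)"
    using upper_expectation_mono[OF fg] g dv rv by (simp add: upper_expectation_eq_integral)
  show "ROS_value M T R x = DOS_value M (p, y) \<longleftrightarrow>
      (AE \<omega> in M. (\<Sum>t\<le>T. x t \<omega> * (p t \<omega> + R t \<omega>)) = y \<omega>)"
    unfolding split
  proof
    assume eq: "ROS_value M T R x = DOS_value M (p, y)"
    then have "upper_expectation M f = ereal (\<integral>\<omega>. g \<omega> \<partial>M)" using dv rv by simp
    \<comment> \<open>The dual value is a real number, so equality of the values rules out an
      infinite expectation of \<open>f\<close>.\<close>
    moreover from this have "integrable M f"
      by (intro integrable_if_upper_expectation_finite fm) simp
    ultimately have "integrable M (\<lambda>\<omega>. g \<omega> - f \<omega>)" "(\<integral>\<omega>. g \<omega> - f \<omega> \<partial>M) = 0"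
      using g by (auto simp: upper_expectation_eq_integral)
    then have "AE \<omega> in M. g \<omega> - f \<omega> = 0"
      using fg by (subst integral_nonneg_eq_0_iff_AE[symmetric]) auto
    then show "AE \<omega> in M. f \<omega> = g \<omega>" by (auto elim: eventually_mono)
  next
    assume "AE \<omega> in M. f \<omega> = g \<omega>"
    from upper_expectation_cong_AE[OF this] show "ROS_value M T R x = DOS_value M (p, y)"
      using g dv rv by (simp add: upper_expectation_eq_integral)
  qed
qed

section \<open>Stopping times as relaxed strategies\<close>

lemma filtration_uptoD:
  assumes "filtration_upto M T F" "t \<le> T"
  shows "subalgebra M (F t)" "space (F t) = space M" "sets (F t) \<subseteq> sets M"
    "s \<le> t \<Longrightarrow> sets (F s) \<subseteq> sets (F t)"
  using assms by (auto simp: filtration_upto_def subalgebra_def)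

lemma stopping_time_eq_sets:
  assumes F: "filtration_upto M T F" and \<tau>: "\<tau> \<in> stopping_times M T F" and t: "t \<le> T"
  shows "{\<omega> \<in> space M. \<tau> \<omega> = t} \<in> sets (F t)"
proof (cases t)
  case 0
  then have "{\<omega> \<in> space M. \<tau> \<omega> = t} = {\<omega> \<in> space M. \<tau> \<omega> \<le> t}" by auto
  with \<tau> t show ?thesis by (simp add: stopping_times_def)
next
  case (Suc s)
  then have "{\<omega> \<in> space M. \<tau> \<omega> = t} = {\<omega> \<in> space M. \<tau> \<omega> \<le> t} - {\<omega> \<in> space M. \<tau> \<omega> \<le> s}" by auto
  moreover have "{\<omega> \<in> space M. \<tau> \<omega> \<le> s} \<in> sets (F t)"
    using \<tau> t Suc filtration_uptoD(4)[OF F t, of s] by (auto simp: stopping_times_def)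
  ultimately show ?thesis using \<tau> t by (auto simp: stopping_times_def)
qed

lemma sum_indicator_stopped:
  "(\<Sum>t\<le>T. z t \<omega> * (if \<tau> \<omega> = t then 1 else 0)) = stopped T z \<tau> \<omega>"
proof -
  have "(\<Sum>t\<le>T. z t \<omega> * (if \<tau> \<omega> = t then 1 else 0)) = (\<Sum>t\<le>T. if \<tau> \<omega> = t then z t \<omega> else 0)"
    by (intro sum.cong) auto
  then show ?thesis by (simp add: stopped_def)
qed

lemma stopping_time_ROS_feasible:
  assumes F: "filtration_upto M T F" and \<tau>: "\<tau> \<in> stopping_times M T F"
  shows "(\<lambda>t \<omega>. if \<tau> \<omega> = t then 1 else 0) \<in> ROS_feasible M T F"
  (is "?x \<in> _")
proof -
  have Ft: "?x t \<in> borel_measurable (F t)" if "t \<le> T" for t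
    using stopping_time_eq_sets[OF F \<tau> that] filtration_uptoD(2)[OF F that]
    by (intro measurable_If) auto
  have M: "?x t \<in> borel_measurable M" if "t \<le> T" for t
    using measurable_from_subalg[OF filtration_uptoD(1)[OF F that] Ft[OF that]] .
  have "?x \<in> adapted_processes M T F"
    unfolding adapted_processes_def L0_def
  proof (intro CollectI conjI allI impI)
    fix t assume "t \<le> T"
    with Ft[OF this] show "\<exists>x'\<in>borel_measurable (F t). AE \<omega> in M. ?x t \<omega> = x' \<omega>"
      by (intro bexI[of _ "?x t"]) auto
  qed (use M in auto)
  \<comment> \<open>The sum is 0 rather than 1 when \<open>\<tau> \<omega> = T + 1\<close>: never
    stopping is the zero strategy.\<close>
  moreover have "(\<Sum>t\<le>T. ?x t \<omega>) \<le> 1" for \<omega>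
    by (simp add: sum.delta')
  ultimately show ?thesis
    unfolding ROS_feasible_def by auto
qed

lemma OS_value_eq_ROS_value:
  "OS_value M T R \<tau> = ROS_value M T R (\<lambda>t \<omega>. if \<tau> \<omega> = t then 1 else 0)"
  unfolding OS_value_def ROS_value_def sum_indicator_stopped ..

section \<open>Conditional expectations and the annihilator of adapted processes\<close>

lemma sigma_finite_subalgebra_prob:
  assumes "prob_space M" "subalgebra M G"
  shows "sigma_finite_subalgebra M G"
proof -
  interpret prob_space M by fact
  interpret finite_measure_subalgebra M G using assms(2) by unfold_locales
  show ?thesis by (rule sigma_finite_subalgebra_axioms)
qed

text \<open>Conditional expectation contracts the L1 norm. Both f and -f lie below \<bar>f\<bar>, so
  monotonicity bounds the absolute value of the conditional expectation by that of \<bar>f\<bar>,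
  whose mean is unchanged.\<close>

lemma integral_abs_real_cond_exp_le:
  assumes "sigma_finite_subalgebra M G" and f: "integrable M f"
  shows "(\<integral>\<omega>. \<bar>real_cond_exp M G f \<omega>\<bar> \<partial>M) \<le> (\<integral>\<omega>. \<bar>f \<omega>\<bar> \<partial>M)"
proof -
  interpret sigma_finite_subalgebra M G by fact
  have a: "integrable M (\<lambda>\<omega>. \<bar>f \<omega>\<bar>)" using f by simp
  have n: "integrable M (\<lambda>\<omega>. - 1 * f \<omega>)" using f by simp
  have "AE \<omega> in M. real_cond_exp M G f \<omega> \<le> real_cond_exp M G (\<lambda>\<omega>. \<bar>f \<omega>\<bar>) \<omega>"
    by (rule real_cond_exp_mono[OF _ f a]) simp
  moreover have "AE \<omega> in M. real_cond_exp M G (\<lambda>\<omega>. - 1 * f \<omega>) \<omega> \<le> real_cond_exp M G (\<lambda>\<omega>. \<bar>f \<omega>\<bar>) \<omega>"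
    by (rule real_cond_exp_mono[OF _ n a]) simp
  ultimately have "AE \<omega> in M. \<bar>real_cond_exp M G f \<omega>\<bar> \<le> real_cond_exp M G (\<lambda>\<omega>. \<bar>f \<omega>\<bar>) \<omega>"
    using real_cond_exp_cmult[OF f, of "- 1"] by eventually_elim auto
  then have "(\<integral>\<omega>. \<bar>real_cond_exp M G f \<omega>\<bar> \<partial>M) \<le> (\<integral>\<omega>. real_cond_exp M G (\<lambda>\<omega>. \<bar>f \<omega>\<bar>) \<omega> \<partial>M)"
    using real_cond_exp_int(1)[OF f] real_cond_exp_int(1)[OF a] by (intro integral_mono_AE) auto
  with real_cond_exp_int(2)[OF a] show ?thesis by simp
qed

text \<open>Boundedness places \<open>q\<close> in \<open>V\<close>. Orthogonality holds time by
  time: an adapted factor can be moved through the conditional expectation, which is zero.\<close>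

lemma bounded_centred_in_adapted_perp:
  assumes M: "prob_space M" and F: "filtration_upto M T F" and D: "dual_pair M (Suc T) X V"
    and q: "q \<in> Linf M (Suc T)"
    and q0: "\<And>t. t \<le> T \<Longrightarrow> AE \<omega> in M. real_cond_exp M (F t) (q t) \<omega> = 0"
  shows "q \<in> adapted_perp M T F X V"
proof -
  have qV: "q \<in> V" using dual_pair_Linf_subset[OF dual_pair_swap[OF D]] q by blast
  have "pairing M (Suc T) x q = 0" if x: "x \<in> adapted_part M T F X" for x
  proof -
    have xX: "x \<in> X" using x by (simp add: adapted_part_def)
    have i: "integrable M (\<lambda>\<omega>. x t \<omega> * q t \<omega>)" if "t \<le> T" for t
      using dual_pair_integrable_mult[OF D xX qV] that by simp
    have "(\<integral>\<omega>. x t \<omega> * q t \<omega> \<partial>M) = 0" if t: "t \<le> T" for t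
    proof -
      interpret sigma_finite_subalgebra M "F t"
        using sigma_finite_subalgebra_prob[OF M filtration_uptoD(1)[OF F t]] .
      \<comment> \<open>\<open>x t\<close> itself is only almost surely equal to an
        \<open>F t\<close>-measurable variable, and the averaging identity requires a truly
        measurable factor.\<close>
      obtain x' where x'[measurable]: "x' \<in> borel_measurable (F t)" and eq: "AE \<omega> in M. x t \<omega> = x' \<omega>"
        using x t by (auto simp: adapted_part_def adapted_processes_def)
      have x'M[measurable]: "x' \<in> borel_measurable M" using measurable_from_subalg[OF subalg x'] .
      have [measurable]: "q t \<in> borel_measurable M" using dual_pair_memD[OF dual_pair_swap[OF D] qV] t by simp
      have [measurable]: "x t \<in> borel_measurable M" using dual_pair_memD[OF D xX] t by simp
      have eq': "AE \<omega> in M. x t \<omega> * q t \<omega> = x' \<omega> * q t \<omega>" using eq by (auto elim: eventually_mono)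
      have "integrable M (\<lambda>\<omega>. x' \<omega> * q t \<omega>)"
        using i[OF t] integrable_cong_AE[OF _ _ eq'] by simp
      from real_cond_exp_intg(2)[OF this]
      have "(\<integral>\<omega>. x' \<omega> * q t \<omega> \<partial>M) = (\<integral>\<omega>. x' \<omega> * real_cond_exp M (F t) (q t) \<omega> \<partial>M)"
        by simp
      also have "\<dots> = (\<integral>\<omega>. 0 \<partial>M)"
        using q0[OF t] by (intro integral_cong_AE) (auto elim: eventually_mono)
      finally show ?thesis using integral_cong_AE[OF _ _ eq'] by simp
    qed
    with i show ?thesis
      by (simp add: pairing_def lessThan_Suc_atMost)
  qed
  with qV show ?thesis by (simp add: annihilator_def)
qed

section \<open>The Snell recursion\<close>

text \<open>
  Backward induction: the pair \<open>(\<tau>, y)\<close> for times \<open>\<ge> Suc n\<close> is updated by comparing \<open>R n\<close> with the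
  continuation value \<open>C = E[y | F n]\<close>; the new \<open>y\<close> adds \<open>(R n - C)\<^sup>+\<close>, and \<open>p n = y - C\<close>.
\<close>

lemma snell_backward:
  fixes R :: "nat \<Rightarrow> 'a \<Rightarrow> real"
  assumes M: "prob_space M" and F: "filtration_upto M T F"
    and Rm: "\<And>t. t \<le> T \<Longrightarrow> R t \<in> borel_measurable (F t)"
    and Ri: "\<And>t. t \<le> T \<Longrightarrow> integrable M (\<lambda>\<omega>. max 0 (R t \<omega>))"
    and n: "n \<le> Suc T"
  shows "\<exists>\<tau> y p. \<tau> \<in> stopping_times M T F \<and> (\<forall>\<omega>\<in>space M. n \<le> \<tau> \<omega>) \<and>
    integrable M y \<and> (AE \<omega> in M. 0 \<le> y \<omega>) \<and>
    (\<forall>t. n \<le> t \<longrightarrow> t \<le> T \<longrightarrow> integrable M (p t) \<and>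
      (AE \<omega> in M. real_cond_exp M (F t) (p t) \<omega> = 0) \<and> (AE \<omega> in M. p t \<omega> + R t \<omega> \<le> y \<omega>)) \<and>
    integrable M (stopped T R \<tau>) \<and>
    (\<forall>m\<le>T. m \<le> n \<longrightarrow> (\<forall>B\<in>sets (F m).
      (\<integral>\<omega>. indicator B \<omega> * y \<omega> \<partial>M) = (\<integral>\<omega>. indicator B \<omega> * stopped T R \<tau> \<omega> \<partial>M)))"
  using n
proof (induction n rule: inc_induct)
  \<comment> \<open>Never stopping has reward 0, matched by y = 0; the conditions on
    \<open>p\<close> are vacuous. The last clause ranges over m \<le> T, so no \<sigma>-algebra at
    time T + 1 is involved.\<close>
  case base
  have "stopped T R (\<lambda>_. Suc T) = (\<lambda>_. 0)" by (auto simp: stopped_def)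
  then show ?case
    by (intro exI[of _ "\<lambda>_. Suc T"] exI[of _ "\<lambda>_. 0"]) (auto simp: stopping_times_def)
next
  case (step n)
  then have nT: "n \<le> T" by simp
  interpret prob_space M by fact
  interpret sigma_finite_subalgebra M "F n"
    using sigma_finite_subalgebra_prob[OF M filtration_uptoD(1)[OF F nT]] .
  have space_F: "space (F t) = space M" "sets (F t) \<subseteq> sets M" if "t \<le> T" for t
    using filtration_uptoD[OF F that] by auto
  have F_mono: "sets (F s) \<subseteq> sets (F t)" if "s \<le> t" "t \<le> T" for s t
    using filtration_uptoD(4)[OF F that(2,1)] .
  obtain \<tau> y p where \<tau>: "\<tau> \<in> stopping_times M T F" and \<tau>n: "\<And>\<omega>. \<omega> \<in> space M \<Longrightarrow> Suc n \<le> \<tau> \<omega>"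
    and y: "integrable M y" and y0: "AE \<omega> in M. 0 \<le> y \<omega>"
    and p: "\<And>t. Suc n \<le> t \<Longrightarrow> t \<le> T \<Longrightarrow> integrable M (p t) \<and>
      (AE \<omega> in M. real_cond_exp M (F t) (p t) \<omega> = 0) \<and> (AE \<omega> in M. p t \<omega> + R t \<omega> \<le> y \<omega>)"
    and Rt: "integrable M (stopped T R \<tau>)"
    and inv: "\<And>m B. m \<le> T \<Longrightarrow> m \<le> Suc n \<Longrightarrow> B \<in> sets (F m) \<Longrightarrow>
      (\<integral>\<omega>. indicator B \<omega> * y \<omega> \<partial>M) = (\<integral>\<omega>. indicator B \<omega> * stopped T R \<tau> \<omega> \<partial>M)"
    using step.IH by blast
  define C where "C = real_cond_exp M (F n) y"
  \<comment> \<open>The region where stopping at once is at least as good as continuing; ties are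
    stopped.\<close>
  define A where "A = {\<omega> \<in> space M. C \<omega> \<le> R n \<omega>}"
  define \<tau>' where "\<tau>' = (\<lambda>\<omega>. if \<omega> \<in> A then n else \<tau> \<omega>)"
  define y' where "y' = (\<lambda>\<omega>. y \<omega> + max 0 (R n \<omega> - C \<omega>))"
  define p' where "p' = p(n := \<lambda>\<omega>. y \<omega> - C \<omega>)"
  have [measurable]: "C \<in> borel_measurable (F n)" "C \<in> borel_measurable M" "R n \<in> borel_measurable (F n)"
    using Rm[OF nT] by (auto simp: C_def)
  have RM[measurable]: "R n \<in> borel_measurable M"
    using measurable_from_subalg[OF subalg Rm[OF nT]] .
  have C: "integrable M C" using real_cond_exp_int(1)[OF y] by (simp add: C_def)
  have C0: "AE \<omega> in M. 0 \<le> C \<omega>" using real_cond_exp_pos[OF y0] y by (simp add: C_def)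
  have A_F: "A \<in> sets (F n)"
  proof -
    have "{\<omega> \<in> space (F n). C \<omega> \<le> R n \<omega>} \<in> sets (F n)" by measurable
    then show ?thesis by (simp add: A_def space_F nT)
  qed
  then have A_M[measurable]: "A \<in> sets M" using space_F nT by blast
  \<comment> \<open>Only the positive part of \<open>R n\<close> is known to be integrable. It
    dominates this increment because C \<ge> 0 almost surely.\<close>
  have pos: "integrable M (\<lambda>\<omega>. max 0 (R n \<omega> - C \<omega>))"
    by (rule Bochner_Integration.integrable_bound[OF Ri[OF nT]]) (use C0 in \<open>auto elim!: eventually_mono\<close>)
  then have y'i: "integrable M y'" using y by (simp add: y'_def)
  \<comment> \<open>On \<open>A\<close> the reward is at least C, hence nonnegative almost surely,
    so again its positive part suffices.\<close>
  have RAi: "integrable M (\<lambda>\<omega>. indicator A \<omega> * R n \<omega>)"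
    by (rule Bochner_Integration.integrable_bound[OF Ri[OF nT]])
      (use C0 in \<open>auto simp: A_def indicator_def elim!: eventually_mono\<close>)
  have stop': "stopped T R \<tau>' \<omega> = indicator A \<omega> * R n \<omega> + indicator (space M - A) \<omega> * stopped T R \<tau> \<omega>"
    if "\<omega> \<in> space M" for \<omega>
    using nT that by (auto simp: stopped_def \<tau>'_def indicator_def)
  have \<tau>'s: "\<tau>' \<in> stopping_times M T F"
  proof -
    have "\<tau>' \<in> measurable M (count_space {0..T+1})"
      unfolding \<tau>'_def using \<tau> nT
      by (intro measurable_If_set) (auto simp: stopping_times_def)
    moreover have "{\<omega> \<in> space M. \<tau>' \<omega> \<le> t} \<in> sets (F t)" if t: "t \<le> T" for t
    proof (cases "n \<le> t")
      case True
      have "{\<omega> \<in> space M. \<tau>' \<omega> \<le> t} = A \<union> {\<omega> \<in> space M. \<tau> \<omega> \<le> t}"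
        using True by (auto simp: \<tau>'_def A_def)
      moreover have "A \<in> sets (F t)" using F_mono[OF True t] A_F by blast
      ultimately show ?thesis using \<tau> t by (auto simp: stopping_times_def)
    next
      case False
      then have "{\<omega> \<in> space M. \<tau>' \<omega> \<le> t} = {}" using \<tau>n by (force simp: \<tau>'_def dest: Suc_leD order_trans)
      then show ?thesis by (simp only: sets.empty_sets)
    qed
    ultimately show ?thesis by (simp add: stopping_times_def)
  qed
  have "integrable M (\<lambda>\<omega>. indicator A \<omega> * R n \<omega> + indicator (space M - A) \<omega> * stopped T R \<tau> \<omega>)"
    using RAi integrable_real_mult_indicator[OF _ Rt, of "space M - A"]
    by (intro Bochner_Integration.integrable_add) (auto simp: mult.commute)
  then have Rt': "integrable M (stopped T R \<tau>')"
    by (subst Bochner_Integration.integrable_cong[OF refl stop'])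
  have p'n: "integrable M (p' n)" "AE \<omega> in M. real_cond_exp M (F n) (p' n) \<omega> = 0"
    "AE \<omega> in M. p' n \<omega> + R n \<omega> \<le> y' \<omega>"
  proof -
    show "integrable M (p' n)" using y C by (simp add: p'_def)
    show "AE \<omega> in M. real_cond_exp M (F n) (p' n) \<omega> = 0"
      using real_cond_exp_diff[OF y C] real_cond_exp_F_meas[OF C]
      by (auto simp: p'_def C_def elim!: eventually_elim2)
    show "AE \<omega> in M. p' n \<omega> + R n \<omega> \<le> y' \<omega>"
      by (auto simp: p'_def y'_def)
  qed
  \<comment> \<open>Split \<open>B\<close> along \<open>A\<close>. On \<open>B \<inter> A\<close>
    the new \<open>y'\<close> is y + R n - C, and y and C cancel under the integral since this set
    is in \<open>F n\<close>; on \<open>B - A\<close> nothing has changed and the induction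
    hypothesis applies.\<close>
  have inv': "(\<integral>\<omega>. indicator B \<omega> * y' \<omega> \<partial>M) = (\<integral>\<omega>. indicator B \<omega> * stopped T R \<tau>' \<omega> \<partial>M)"
    if B: "B \<in> sets (F n)" for B
  proof -
    have BM[measurable]: "B \<in> sets M" using B space_F nT by blast
    have BA: "B \<inter> A \<in> sets (F n)" "B - A \<in> sets (F n)" using B A_F by auto
    have ind: "integrable M (\<lambda>\<omega>. indicator E \<omega> * f \<omega>)" if "integrable M f" "E \<in> sets M" for E and f :: "'a \<Rightarrow> real"
      using integrable_real_mult_indicator[OF that(2,1)] by (simp add: mult.commute)
    have RBA: "integrable M (\<lambda>\<omega>. indicator (B \<inter> A) \<omega> * R n \<omega>)"
      using ind[OF RAi BM] by (simp add: indicator_inter_arith mult.assoc)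
    have CBA: "(\<integral>\<omega>. indicator (B \<inter> A) \<omega> * C \<omega> \<partial>M) = (\<integral>\<omega>. indicator (B \<inter> A) \<omega> * y \<omega> \<partial>M)"
      using real_cond_exp_intA[OF y BA(1)] by (simp add: set_lebesgue_integral_def C_def)
    have "(\<integral>\<omega>. indicator B \<omega> * y' \<omega> \<partial>M) =
      (\<integral>\<omega>. indicator (B - A) \<omega> * y \<omega> + (indicator (B \<inter> A) \<omega> * y \<omega> + (indicator (B \<inter> A) \<omega> * R n \<omega> - indicator (B \<inter> A) \<omega> * C \<omega>)) \<partial>M)"
      by (intro Bochner_Integration.integral_cong) (auto simp: y'_def A_def indicator_def)
    also have "\<dots> = (\<integral>\<omega>. indicator (B - A) \<omega> * y \<omega> \<partial>M) + (\<integral>\<omega>. indicator (B \<inter> A) \<omega> * R n \<omega> \<partial>M)"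
      using RBA CBA ind[OF y, of "B - A"] ind[OF y, of "B \<inter> A"] ind[OF C, of "B \<inter> A"] by simp
    also have "\<dots> = (\<integral>\<omega>. indicator (B - A) \<omega> * stopped T R \<tau> \<omega> \<partial>M) + (\<integral>\<omega>. indicator (B \<inter> A) \<omega> * R n \<omega> \<partial>M)"
      using inv[OF nT _ BA(2)] by simp
    also have "\<dots> = (\<integral>\<omega>. indicator (B - A) \<omega> * stopped T R \<tau> \<omega> + indicator (B \<inter> A) \<omega> * R n \<omega> \<partial>M)"
      using RBA ind[OF Rt, of "B - A"] by simp
    also have "\<dots> = (\<integral>\<omega>. indicator B \<omega> * stopped T R \<tau>' \<omega> \<partial>M)"
      by (intro Bochner_Integration.integral_cong) (auto simp: stop' indicator_def)
    finally show ?thesis .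
  qed
  show ?case
  proof (rule exI[of _ \<tau>'], rule exI[of _ y'], rule exI[of _ p'], intro conjI allI impI ballI)
    show "n \<le> \<tau>' \<omega>" if "\<omega> \<in> space M" for \<omega>
      using \<tau>n[OF that] by (auto simp: \<tau>'_def)
    show "AE \<omega> in M. 0 \<le> y' \<omega>" using y0 by (auto simp: y'_def elim!: eventually_mono)
    fix t assume t: "n \<le> t" "t \<le> T"
    show "integrable M (p' t)" "AE \<omega> in M. real_cond_exp M (F t) (p' t) \<omega> = 0"
      using p'n(1,2) p[of t] t by (cases "t = n"; simp add: p'_def)+
    show "AE \<omega> in M. p' t \<omega> + R t \<omega> \<le> y' \<omega>"
    proof (cases "t = n")
      case False
      \<comment> \<open>At later times \<open>p\<close> is kept and \<open>y' \<ge> y\<close>, so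
        the old constraint survives.\<close>
      with t p[of t] have "AE \<omega> in M. p t \<omega> + R t \<omega> \<le> y \<omega>" by simp
      with False show ?thesis by (auto simp: p'_def y'_def elim!: eventually_mono)
    qed (use p'n in simp)
  next
    fix m B assume "m \<le> T" "m \<le> n" "B \<in> sets (F m)"
    then show "(\<integral>\<omega>. indicator B \<omega> * y' \<omega> \<partial>M) = (\<integral>\<omega>. indicator B \<omega> * stopped T R \<tau>' \<omega> \<partial>M)"
      using inv' F_mono[of m n] nT by blast
  qed (use \<tau>'s y'i Rt' in auto)
qed

section \<open>Closing the gap between stopping and the dual\<close>

text \<open>Needed because optimality of a stopping time and of a dual pair, assumed separately,
  says nothing about their values being equal. The infimum is approached along feasible
  approximations of the Snell pair, which itself may fail to be feasible.\<close>

lemma INF_DOS_le_OS_value: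
  assumes M: "prob_space M" and F: "filtration_upto M T F"
    and D: "dual_pair M (Suc T) X V" and D': "scalar_dual_pair M U Y"
    and R: "R \<in> adapted_processes M T F"
    and maxR: "(\<lambda>\<omega>. MAX t\<in>{0..T}. R t \<omega>) \<in> Y"
  shows "\<exists>\<tau>\<in>stopping_times M T F. (INF d\<in>DOS_feasible M T F R X V Y. DOS_value M d) \<le> OS_value M T R \<tau>"
proof -
  interpret prob_space M by fact
  define Z where "Z = (\<lambda>\<omega>. MAX t\<in>{0..T}. R t \<omega>)"
  have Zi: "integrable M Z" using scalar_dual_pair_integrable[OF D' maxR] by (simp add: Z_def)
  have RZ: "R t \<omega> \<le> Z \<omega>" if "t \<le> T" for t \<omega>
    using that by (auto simp: Z_def)
  have RM[measurable]: "R t \<in> borel_measurable M" if "t \<le> T" for t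
    using R that by (auto simp: adapted_processes_def L0_def)
  \<comment> \<open>The recursion compares rewards with continuation values, and its stopping
    regions must lie in \<open>F t\<close> exactly; hence the passage to measurable
    versions.\<close>
  have "\<forall>t\<in>{..T}. \<exists>x'. x' \<in> borel_measurable (F t) \<and> (AE \<omega> in M. R t \<omega> = x' \<omega>)"
    using R by (auto simp: adapted_processes_def)
  from bchoice[OF this] obtain R' where R'm: "\<And>t. t \<le> T \<Longrightarrow> R' t \<in> borel_measurable (F t)"
    and R'eq: "\<And>t. t \<le> T \<Longrightarrow> AE \<omega> in M. R t \<omega> = R' t \<omega>"
    by auto
  have R'M: "R' t \<in> borel_measurable M" if "t \<le> T" for t
    using measurable_from_subalg[OF filtration_uptoD(1)[OF F that] R'm[OF that]] .
  have R'i: "integrable M (\<lambda>\<omega>. max 0 (R' t \<omega>))" if t: "t \<le> T" for t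
  proof (rule Bochner_Integration.integrable_bound[OF Zi])
    show "(\<lambda>\<omega>. max 0 (R' t \<omega>)) \<in> borel_measurable M" using R'M[OF t] by measurable
    show "AE \<omega> in M. norm (max 0 (R' t \<omega>)) \<le> norm (Z \<omega>)"
      using R'eq[OF t]
    proof eventually_elim
      case (elim \<omega>)
      with RZ[OF t, of \<omega>] show ?case by auto
    qed
  qed
  obtain \<tau> y p where \<tau>: "\<tau> \<in> stopping_times M T F"
    and y: "integrable M y" and y0: "AE \<omega> in M. 0 \<le> y \<omega>"
    and p_all: "\<forall>t\<le>T. integrable M (p t) \<and> (AE \<omega> in M. real_cond_exp M (F t) (p t) \<omega> = 0) \<and>
      (AE \<omega> in M. p t \<omega> + R' t \<omega> \<le> y \<omega>)"
    and Rt: "integrable M (stopped T R' \<tau>)"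
    and inv: "\<forall>B\<in>sets (F 0).
      (\<integral>\<omega>. indicator B \<omega> * y \<omega> \<partial>M) = (\<integral>\<omega>. indicator B \<omega> * stopped T R' \<tau> \<omega> \<partial>M)"
    using snell_backward[where R = R' and n = 0, OF M F R'm R'i le0, simplified]
    by (elim exE conjE) (rule that; simp)
  have p: "integrable M (p t)" "AE \<omega> in M. real_cond_exp M (F t) (p t) \<omega> = 0"
    "AE \<omega> in M. p t \<omega> + R' t \<omega> \<le> y \<omega>" if "t \<le> T" for t
    using p_all that by auto
  \<comment> \<open>Testing the invariant at time 0 with the whole space turns it into equality of
    means.\<close>
  have "space M \<in> sets (F 0)"
    using filtration_uptoD(2)[OF F, of 0] sets.top[of "F 0"] by simp
  from bspec[OF inv this] have Ey: "(\<integral>\<omega>. stopped T R' \<tau> \<omega> \<partial>M) = (\<integral>\<omega>. y \<omega> \<partial>M)"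
    by (simp cong: Bochner_Integration.integral_cong)
  have "AE \<omega> in M. \<forall>t\<in>{..T}. R t \<omega> = R' t \<omega>"
    using R'eq by (intro AE_finite_allI) auto
  then have "AE \<omega> in M. stopped T R \<tau> \<omega> = stopped T R' \<tau> \<omega>"
    by eventually_elim (auto simp: stopped_def)
  from upper_expectation_cong_AE[OF this] have OS: "OS_value M T R \<tau> = ereal (\<integral>\<omega>. y \<omega> \<partial>M)"
    using Rt Ey by (simp add: OS_value_def upper_expectation_eq_integral)

  \<comment> \<open>\<open>p\<close> and \<open>y\<close> need not lie in \<open>V\<close> and \<open>Y\<close>; truncating \<open>p\<close> and recentring puts it in \<open>Linf \<subseteq> V\<close>.\<close>
  define q where "q = (\<lambda>(k::nat) t \<omega>. max (- real k) (min (real k) (p t \<omega>)))"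
  define e where "e = (\<lambda>k t. \<integral>\<omega>. \<bar>q k t \<omega> - p t \<omega>\<bar> \<partial>M)"
  have pM[measurable]: "p t \<in> borel_measurable M" if "t \<le> T" for t
    using p(1)[OF that] by simp
  have qM[measurable]: "q k t \<in> borel_measurable M" if "t \<le> T" for k t
    unfolding q_def using that by measurable
  have qb: "\<bar>q k t \<omega>\<bar> \<le> real k" for k t \<omega> by (auto simp: q_def)
  have qi: "integrable M (q k t)" if "t \<le> T" for k t
    by (rule integrable_const_bound[of _ "real k"]) (use qb qM[OF that] in auto)
  \<comment> \<open>Pointwise the error is 0 as soon as k \<ge> \<bar>p t \<omega>\<bar>, and it
    never exceeds \<bar>p t\<bar>, which is integrable.\<close>
  have e0: "(\<lambda>k. e k t) \<longlonglongrightarrow> 0" if t: "t \<le> T" for t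
  proof -
    have "(\<lambda>k. e k t) \<longlonglongrightarrow> (\<integral>\<omega>. 0 \<partial>M)"
      unfolding e_def
    proof (rule integral_dominated_convergence[where w = "\<lambda>\<omega>. \<bar>p t \<omega>\<bar>"])
      show "AE \<omega> in M. (\<lambda>k. \<bar>q k t \<omega> - p t \<omega>\<bar>) \<longlonglongrightarrow> 0"
      proof (intro AE_I2)
        fix \<omega>
        have "\<forall>\<^sub>F k in sequentially. \<bar>q k t \<omega> - p t \<omega>\<bar> = 0"
          using eventually_ge_at_top[of "nat \<lceil>\<bar>p t \<omega>\<bar>\<rceil>"]
        proof eventually_elim
          case (elim k)
          then have "\<bar>p t \<omega>\<bar> \<le> real k" by linarith
          then show ?case by (auto simp: q_def)
        qed
        then show "(\<lambda>k. \<bar>q k t \<omega> - p t \<omega>\<bar>) \<longlonglongrightarrow> 0" by (rule tendsto_eventually)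
      qed
      show "AE \<omega> in M. norm \<bar>q k t \<omega> - p t \<omega>\<bar> \<le> \<bar>p t \<omega>\<bar>" for k
        by (auto simp: q_def)
    qed (use p(1)[OF t] qM[OF t] pM[OF t] in auto)
    then show ?thesis by simp
  qed
  \<comment> \<open>The factor 2 arises because truncation and recentring each cost at most
    \<open>e k t\<close> in L1.\<close>
  have bound: "(INF d\<in>DOS_feasible M T F R X V Y. DOS_value M d)
    \<le> ereal ((\<integral>\<omega>. y \<omega> \<partial>M) + (\<Sum>t\<le>T. 2 * e k t))" for k
  proof -
    define p' where "p' = (\<lambda>t \<omega>. q k t \<omega> - real_cond_exp M (F t) (q k t) \<omega>)"
    \<comment> \<open>The smallest nonnegative variable satisfying the dual constraints for
      \<open>p'\<close>.\<close>
    define y' where "y' = (\<lambda>\<omega>. max 0 (MAX t\<in>{0..T}. p' t \<omega> + R t \<omega>))"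
    have p'M[measurable]: "p' t \<in> borel_measurable M" if "t \<le> T" for t
      using qM[OF that] by (simp add: p'_def)
    have p'b: "AE \<omega> in M. \<bar>p' t \<omega>\<bar> \<le> 2 * real k" if t: "t \<le> T" for t
    proof -
      interpret sigma_finite_subalgebra M "F t"
        using sigma_finite_subalgebra_prob[OF M filtration_uptoD(1)[OF F t]] .
      have "AE \<omega> in M. real_cond_exp M (F t) (q k t) \<omega> \<le> real k"
        "AE \<omega> in M. real_cond_exp M (F t) (q k t) \<omega> \<ge> - real k"
        using qb[of k t] by (auto intro!: real_cond_exp_le_c real_cond_exp_ge_c qi[OF t] simp: abs_le_iff minus_le_iff)
      then show ?thesis
        by eventually_elim (use qb[of k t] in \<open>auto simp: p'_def abs_le_iff minus_le_iff; smt (verit)\<close>)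
    qed
    have p'perp: "p' \<in> adapted_perp M T F X V"
    proof (rule bounded_centred_in_adapted_perp[OF M F D])
      show "p' \<in> Linf M (Suc T)"
        unfolding Linf_def L0_def using p'M p'b by (auto intro!: exI[of _ "2 * real k"])
      fix t assume t: "t \<le> T"
      interpret sigma_finite_subalgebra M "F t"
        using sigma_finite_subalgebra_prob[OF M filtration_uptoD(1)[OF F t]] .
      show "AE \<omega> in M. real_cond_exp M (F t) (p' t) \<omega> = 0"
        using real_cond_exp_diff[OF qi[OF t, of k] real_cond_exp_int(1)[OF qi[OF t, of k]]]
          real_cond_exp_F_meas[OF real_cond_exp_int(1)[OF qi[OF t, of k]] borel_measurable_cond_exp]
        unfolding p'_def by eventually_elim simp
    qed
    \<comment> \<open>Since \<open>p t\<close> is centred, recentring \<open>q k t\<close> subtracts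
      the conditional expectation of the difference \<open>?d = q k t - p t\<close>. Thus
      \<open>p' t - p t\<close> is \<open>?d\<close> minus its own conditional expectation, and the
      L1 contraction applies.\<close>
    have p'p: "integrable M (\<lambda>\<omega>. \<bar>p' t \<omega> - p t \<omega>\<bar>)" "(\<integral>\<omega>. \<bar>p' t \<omega> - p t \<omega>\<bar> \<partial>M) \<le> 2 * e k t"
      if t: "t \<le> T" for t
    proof -
      interpret sigma_finite_subalgebra M "F t"
        using sigma_finite_subalgebra_prob[OF M filtration_uptoD(1)[OF F t]] .
      let ?d = "\<lambda>\<omega>. q k t \<omega> - p t \<omega>"
      have d: "integrable M ?d" using qi[OF t] p(1)[OF t] by simp
      note dc = real_cond_exp_int(1)[OF d]
      show "integrable M (\<lambda>\<omega>. \<bar>p' t \<omega> - p t \<omega>\<bar>)"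
        using qi[OF t, of k] real_cond_exp_int(1)[OF qi[OF t, of k]] p(1)[OF t] by (simp add: p'_def)
      moreover have "AE \<omega> in M. \<bar>p' t \<omega> - p t \<omega>\<bar> \<le> \<bar>?d \<omega>\<bar> + \<bar>real_cond_exp M (F t) ?d \<omega>\<bar>"
        using real_cond_exp_diff[OF qi[OF t, of k] p(1)[OF t]] p(2)[OF t]
        by eventually_elim (simp add: p'_def)
      ultimately have "(\<integral>\<omega>. \<bar>p' t \<omega> - p t \<omega>\<bar> \<partial>M) \<le> (\<integral>\<omega>. \<bar>?d \<omega>\<bar> + \<bar>real_cond_exp M (F t) ?d \<omega>\<bar> \<partial>M)"
        using d dc by (intro integral_mono_AE) auto
      also have "\<dots> \<le> 2 * e k t"
        using integral_abs_real_cond_exp_le[OF sigma_finite_subalgebra_axioms d] d dc by (simp add: e_def)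
      finally show "(\<integral>\<omega>. \<bar>p' t \<omega> - p t \<omega>\<bar> \<partial>M) \<le> 2 * e k t" .
    qed
    have y'Y: "y' \<in> Y"
    proof (rule scalar_dual_pair_abs_le_add_const[OF D' maxR])
      have "(\<lambda>\<omega>. MAX t\<in>{0..T}. p' t \<omega> + R t \<omega>) \<in> borel_measurable M"
        by (intro borel_measurable_Max) auto
      then show "y' \<in> borel_measurable M" unfolding y'_def by measurable
      have "AE \<omega> in M. \<forall>t\<in>{..T}. \<bar>p' t \<omega>\<bar> \<le> 2 * real k"
        using p'b by (intro AE_finite_allI) auto
      then show "AE \<omega> in M. \<bar>y' \<omega>\<bar> \<le> \<bar>MAX t\<in>{0..T}. R t \<omega>\<bar> + 2 * real k"
      proof eventually_elim
        case (elim \<omega>)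
        \<comment> \<open>An upper bound is enough for \<bar>y'\<bar>, because \<open>y'\<close> is
          cut off below at 0.\<close>
        have "(MAX t\<in>{0..T}. p' t \<omega> + R t \<omega>) \<le> \<bar>Z \<omega>\<bar> + 2 * real k"
        proof (subst Max_le_iff; clarsimp)
          fix t assume t: "t \<le> T"
          with elim RZ[OF t, of \<omega>] show "p' t \<omega> + R t \<omega> \<le> \<bar>Z \<omega>\<bar> + 2 * real k"
            by (smt (verit) atMost_iff)
        qed
        then show ?case by (simp add: y'_def Z_def)
      qed
    qed
    have "(p', y') \<in> DOS_feasible M T F R X V Y"
      using p'perp y'Y by (auto simp: DOS_feasible_def nonneg_part_def y'_def le_max_iff_disj)
    then have "(INF d\<in>DOS_feasible M T F R X V Y. DOS_value M d) \<le> DOS_value M (p', y')"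
      by (rule INF_lower)
    also have "DOS_value M (p', y') \<le> ereal (\<integral>\<omega>. y \<omega> + (\<Sum>t\<le>T. \<bar>p' t \<omega> - p t \<omega>\<bar>) \<partial>M)"
    proof -
      have "AE \<omega> in M. \<forall>t\<in>{..T}. p t \<omega> + R' t \<omega> \<le> y \<omega> \<and> R t \<omega> = R' t \<omega>"
        using p(3) R'eq by (intro AE_finite_allI) auto
      \<comment> \<open>Replacing \<open>p\<close> by \<open>p'\<close> raises each constraint by at
        most one summand, and the sum bounds all of them at once.\<close>
      then have "AE \<omega> in M. y' \<omega> \<le> y \<omega> + (\<Sum>t\<le>T. \<bar>p' t \<omega> - p t \<omega>\<bar>)"
        using y0
      proof eventually_elim
        case (elim \<omega>)
        have "(MAX t\<in>{0..T}. p' t \<omega> + R t \<omega>) \<le> y \<omega> + (\<Sum>t\<le>T. \<bar>p' t \<omega> - p t \<omega>\<bar>)"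
        proof (subst Max_le_iff; clarsimp)
          fix t assume t: "t \<le> T"
          have "\<bar>p' t \<omega> - p t \<omega>\<bar> \<le> (\<Sum>t\<le>T. \<bar>p' t \<omega> - p t \<omega>\<bar>)"
            using t by (intro member_le_sum) auto
          with elim(1) t show "p' t \<omega> + R t \<omega> \<le> y \<omega> + (\<Sum>t\<le>T. \<bar>p' t \<omega> - p t \<omega>\<bar>)"
            by (smt (verit) atMost_iff)
        qed
        with elim(2) show ?case by (simp add: y'_def sum_nonneg)
      qed
      then show ?thesis
        using p'p(1) y scalar_dual_pair_integrable[OF D' y'Y] unfolding DOS_value_def
        by (auto intro!: integral_mono_AE Bochner_Integration.integrable_add Bochner_Integration.integrable_sum)
    qed
    also have "(\<integral>\<omega>. y \<omega> + (\<Sum>t\<le>T. \<bar>p' t \<omega> - p t \<omega>\<bar>) \<partial>M)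
      = (\<integral>\<omega>. y \<omega> \<partial>M) + (\<Sum>t\<le>T. \<integral>\<omega>. \<bar>p' t \<omega> - p t \<omega>\<bar> \<partial>M)"
      using p'p(1) y
      by (subst Bochner_Integration.integral_add)
        (auto intro!: Bochner_Integration.integrable_sum Bochner_Integration.integral_sum)
    also have "ereal \<dots> \<le> ereal ((\<integral>\<omega>. y \<omega> \<partial>M) + (\<Sum>t\<le>T. 2 * e k t))"
      using p'p(2) by (auto intro!: sum_mono)
    finally show ?thesis .
  qed
  have "(\<lambda>k. (\<integral>\<omega>. y \<omega> \<partial>M) + (\<Sum>t\<le>T. 2 * e k t)) \<longlonglongrightarrow> (\<integral>\<omega>. y \<omega> \<partial>M) + (\<Sum>t\<le>T. 2 * 0)"
    using e0 by (intro tendsto_intros) auto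
  then have "(\<lambda>k. ereal ((\<integral>\<omega>. y \<omega> \<partial>M) + (\<Sum>t\<le>T. 2 * e k t))) \<longlonglongrightarrow> OS_value M T R \<tau>"
    by (simp add: OS)
  then have "(INF d\<in>DOS_feasible M T F R X V Y. DOS_value M d) \<le> OS_value M T R \<tau>"
    by (rule LIMSEQ_le_const) (use bound in blast)
  with \<tau> show ?thesis by blast
qed

section \<open>Optimality conditions\<close>

text \<open>Weak duality gives f z \<le> SUP \<le> INF \<le> g w, and equality of the ends collapses
  the chain. Stated abstractly, since it serves both the relaxed problem and the stopping
  problem.\<close>

lemma solves_if_values_eq:
  assumes "z \<in> S" "w \<in> W" "f z = g w" "\<bar>g w\<bar> \<noteq> \<infinity>"
    and weak: "\<And>z w. z \<in> S \<Longrightarrow> w \<in> W \<Longrightarrow> f z \<le> g w"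
  shows "solves_max S f z" "solves_min W g w" "(SUP z\<in>S. f z) = (INF w\<in>W. g w)"
proof -
  have "(SUP z\<in>S. f z) = f z"
    using assms(1,2,3) weak by (intro antisym SUP_least SUP_upper) auto
  moreover have "(INF w\<in>W. g w) = g w"
    using assms(1,2) weak[OF assms(1)] unfolding assms(3) by (intro antisym INF_greatest INF_lower) auto
  ultimately show "solves_max S f z" "solves_min W g w" "(SUP z\<in>S. f z) = (INF w\<in>W. g w)"
    using assms by (auto simp: solves_max_def solves_min_def)
qed

theorem theorem38:
  fixes M :: "'a measure" and T :: nat and F :: "nat \<Rightarrow> 'a measure"
    and X V :: "(nat \<Rightarrow> 'a \<Rightarrow> real) set" and U Y :: "('a \<Rightarrow> real) set"
    and R :: "nat \<Rightarrow> 'a \<Rightarrow> real"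
  assumes "prob_space M"
    and "filtration_upto M T F"
    and "dual_pair M (Suc T) X V"
    and "scalar_dual_pair M U Y"
    and "R \<in> adapted_processes M T F"
    and "(\<lambda>\<omega>. MAX t\<in>{0..T}. R t \<omega>) \<in> Y"
  shows "(\<forall>x p y.
      (solves_max (ROS_feasible M T F) (ROS_value M T R) x \<and>
       solves_min (DOS_feasible M T F R X V Y) (DOS_value M) (p, y) \<and>
       (SUP x'\<in>ROS_feasible M T F. ROS_value M T R x') =
         (INF q\<in>DOS_feasible M T F R X V Y. DOS_value M q))
      \<longleftrightarrow>
      (x \<in> adapted_part M T F X \<and> p \<in> adapted_perp M T F X V \<and> y \<in> Y \<and>
       (AE \<omega> in M.
          (\<forall>t\<le>T. 0 \<le> x t \<omega> \<and> p t \<omega> + R t \<omega> \<le> y \<omega> \<and> x t \<omega> * (p t \<omega> + R t \<omega> - y \<omega>) = 0) \<and>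
          0 \<le> y \<omega> \<and> (\<Sum>t\<le>T. x t \<omega>) \<le> 1 \<and> y \<omega> * ((\<Sum>t\<le>T. x t \<omega>) - 1) = 0)))
    \<and>
    (\<forall>\<tau>\<in>stopping_times M T F. \<forall>p\<in>adapted_perp M T F X V. \<forall>y\<in>nonneg_part M Y.
      (solves_max (stopping_times M T F) (OS_value M T R) \<tau> \<and>
       solves_min (DOS_feasible M T F R X V Y) (DOS_value M) (p, y))
      \<longleftrightarrow>
      (AE \<omega> in M. (\<forall>t\<le>T. p t \<omega> + R t \<omega> \<le> y \<omega>) \<and>
         stopped T p \<tau> \<omega> + stopped T R \<tau> \<omega> = y \<omega>))"
  (is "?ROS \<and> ?OS")
proof
  note M = assms(1) and F = assms(2) and D = assms(3) and D' = assms(4) and R = assms(5) and maxR = assms(6)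
  have weak: "ROS_value M T R x \<le> DOS_value M d"
    if "x \<in> ROS_feasible M T F" "d \<in> DOS_feasible M T F R X V Y" for x d
    using ROS_DOS_weak_duality(1)[OF D D' R that(1), of "fst d" "snd d"] that(2) by simp
  have fin: "\<bar>DOS_value M d\<bar> \<noteq> \<infinity>" for d :: "(nat \<Rightarrow> 'a \<Rightarrow> real) \<times> ('a \<Rightarrow> real)"
    by (cases d) (simp add: DOS_value_def)
  show ?ROS
  proof (intro allI iffI)
    fix x p y
    assume "solves_max (ROS_feasible M T F) (ROS_value M T R) x \<and>
       solves_min (DOS_feasible M T F R X V Y) (DOS_value M) (p, y) \<and>
       (SUP x'\<in>ROS_feasible M T F. ROS_value M T R x') =
         (INF q\<in>DOS_feasible M T F R X V Y. DOS_value M q)"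
    then have x: "x \<in> ROS_feasible M T F" and d: "(p, y) \<in> DOS_feasible M T F R X V Y"
      and eq: "ROS_value M T R x = DOS_value M (p, y)"
      by (auto simp: solves_max_def solves_min_def)
    have "AE \<omega> in M. (\<Sum>t\<le>T. x t \<omega> * (p t \<omega> + R t \<omega>)) = y \<omega>"
      using ROS_DOS_weak_duality(2)[OF D D' R x d] eq by simp
    moreover have "AE \<omega> in M. (\<forall>t\<le>T. 0 \<le> x t \<omega>) \<and> (\<Sum>t\<le>T. x t \<omega>) \<le> 1"
      using x by (simp add: ROS_feasible_def)
    moreover have "AE \<omega> in M. 0 \<le> y \<omega>" "AE \<omega> in M. \<forall>t\<le>T. p t \<omega> + R t \<omega> \<le> y \<omega>"
      using d by (auto simp: DOS_feasible_def nonneg_part_def)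
    ultimately have "AE \<omega> in M.
          (\<forall>t\<le>T. 0 \<le> x t \<omega> \<and> p t \<omega> + R t \<omega> \<le> y \<omega> \<and> x t \<omega> * (p t \<omega> + R t \<omega> - y \<omega>) = 0) \<and>
          0 \<le> y \<omega> \<and> (\<Sum>t\<le>T. x t \<omega>) \<le> 1 \<and> y \<omega> * ((\<Sum>t\<le>T. x t \<omega>) - 1) = 0"
    proof eventually_elim
      case (elim \<omega>)
      with slackness_nonneg(2)[of T "\<lambda>t. x t \<omega>" "\<lambda>t. p t \<omega> + R t \<omega>" "y \<omega>"] show ?case by auto
    qed
    then show "x \<in> adapted_part M T F X \<and> p \<in> adapted_perp M T F X V \<and> y \<in> Y \<and>
       (AE \<omega> in M.
          (\<forall>t\<le>T. 0 \<le> x t \<omega> \<and> p t \<omega> + R t \<omega> \<le> y \<omega> \<and> x t \<omega> * (p t \<omega> + R t \<omega> - y \<omega>) = 0) \<and>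
          0 \<le> y \<omega> \<and> (\<Sum>t\<le>T. x t \<omega>) \<le> 1 \<and> y \<omega> * ((\<Sum>t\<le>T. x t \<omega>) - 1) = 0)"
      using ROS_feasible_subset_adapted_part[OF D] x d
      by (auto simp: DOS_feasible_def nonneg_part_def)
  next
    fix x p y
    assume asm: "x \<in> adapted_part M T F X \<and> p \<in> adapted_perp M T F X V \<and> y \<in> Y \<and>
       (AE \<omega> in M.
          (\<forall>t\<le>T. 0 \<le> x t \<omega> \<and> p t \<omega> + R t \<omega> \<le> y \<omega> \<and> x t \<omega> * (p t \<omega> + R t \<omega> - y \<omega>) = 0) \<and>
          0 \<le> y \<omega> \<and> (\<Sum>t\<le>T. x t \<omega>) \<le> 1 \<and> y \<omega> * ((\<Sum>t\<le>T. x t \<omega>) - 1) = 0)"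
    then have ae: "AE \<omega> in M.
          (\<forall>t\<le>T. 0 \<le> x t \<omega> \<and> p t \<omega> + R t \<omega> \<le> y \<omega> \<and> x t \<omega> * (p t \<omega> + R t \<omega> - y \<omega>) = 0) \<and>
          0 \<le> y \<omega> \<and> (\<Sum>t\<le>T. x t \<omega>) \<le> 1 \<and> y \<omega> * ((\<Sum>t\<le>T. x t \<omega>) - 1) = 0" by blast
    have x: "x \<in> ROS_feasible M T F"
      using asm by (auto simp: ROS_feasible_def adapted_part_def elim!: eventually_mono)
    have d: "(p, y) \<in> DOS_feasible M T F R X V Y"
      using asm by (auto simp: DOS_feasible_def nonneg_part_def elim!: eventually_mono)
    have "AE \<omega> in M. (\<Sum>t\<le>T. x t \<omega> * (p t \<omega> + R t \<omega>)) = y \<omega>"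
      using ae
    proof eventually_elim
      case (elim \<omega>)
      \<comment> \<open>The first slackness condition replaces p + R by y wherever x is nonzero; the
        second then turns y times the sum of x into y.\<close>
      have "(\<Sum>t\<le>T. x t \<omega> * (p t \<omega> + R t \<omega>)) = (\<Sum>t\<le>T. x t \<omega> * y \<omega>)"
        using elim by (intro sum.cong) auto
      also have "\<dots> = y \<omega> * (\<Sum>t\<le>T. x t \<omega>)"
        by (simp add: sum_distrib_left mult.commute)
      also have "\<dots> = y \<omega>" using elim by auto
      finally show ?case .
    qed
    then have "ROS_value M T R x = DOS_value M (p, y)"
      using ROS_DOS_weak_duality(2)[OF D D' R x d] by simp
    note solves_if_values_eq[of x "ROS_feasible M T F" "(p, y)" "DOS_feasible M T F R X V Y"
        "ROS_value M T R" "DOS_value M", OF x d this fin weak]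
    then show "solves_max (ROS_feasible M T F) (ROS_value M T R) x \<and>
       solves_min (DOS_feasible M T F R X V Y) (DOS_value M) (p, y) \<and>
       (SUP x'\<in>ROS_feasible M T F. ROS_value M T R x') =
         (INF q\<in>DOS_feasible M T F R X V Y. DOS_value M q)" by blast
  qed
  have weak': "OS_value M T R \<tau> \<le> DOS_value M d"
    if "\<tau> \<in> stopping_times M T F" "d \<in> DOS_feasible M T F R X V Y" for \<tau> d
    using weak[OF stopping_time_ROS_feasible[OF F that(1)] that(2)] by (simp add: OS_value_eq_ROS_value)
  have eq_iff: "OS_value M T R \<tau> = DOS_value M (p, y) \<longleftrightarrow>
      (AE \<omega> in M. stopped T p \<tau> \<omega> + stopped T R \<tau> \<omega> = y \<omega>)"
    if \<tau>: "\<tau> \<in> stopping_times M T F" and d: "(p, y) \<in> DOS_feasible M T F R X V Y" for \<tau> p y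
  proof -
    have "(\<Sum>t\<le>T. (if \<tau> \<omega> = t then 1 else 0) * (p t \<omega> + R t \<omega>)) = stopped T p \<tau> \<omega> + stopped T R \<tau> \<omega>" for \<omega>
      by (simp add: sum_indicator_stopped[symmetric] sum.distrib[symmetric] algebra_simps)
    then show ?thesis
      using ROS_DOS_weak_duality(2)[OF D D' R stopping_time_ROS_feasible[OF F \<tau>] d]
      by (simp add: OS_value_eq_ROS_value)
  qed
  show ?OS
  proof (intro ballI iffI)
    fix \<tau> p y
    assume \<tau>: "\<tau> \<in> stopping_times M T F" and p: "p \<in> adapted_perp M T F X V" and y: "y \<in> nonneg_part M Y"
    {
      assume "solves_max (stopping_times M T F) (OS_value M T R) \<tau> \<and>
        solves_min (DOS_feasible M T F R X V Y) (DOS_value M) (p, y)"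
      then have d: "(p, y) \<in> DOS_feasible M T F R X V Y"
        and OS: "OS_value M T R \<tau> = (SUP \<sigma>\<in>stopping_times M T F. OS_value M T R \<sigma>)"
        and DOS: "DOS_value M (p, y) = (INF d\<in>DOS_feasible M T F R X V Y. DOS_value M d)"
        by (auto simp: solves_max_def solves_min_def)
      \<comment> \<open>Unlike in the relaxed equivalence, a zero gap is not assumed here. Some
        \<sigma> reaches the dual value, so the optimal \<tau> does too, and weak duality gives the
        converse inequality.\<close>
      from INF_DOS_le_OS_value[OF M F D D' R maxR]
      obtain \<sigma> where \<sigma>: "\<sigma> \<in> stopping_times M T F" "DOS_value M (p, y) \<le> OS_value M T R \<sigma>"
        unfolding DOS by blast
      then have "DOS_value M (p, y) \<le> OS_value M T R \<tau>"
        unfolding OS by (meson SUP_upper order_trans)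
      with weak'[OF \<tau> d] have "OS_value M T R \<tau> = DOS_value M (p, y)" by simp
      with eq_iff[OF \<tau> d] have "AE \<omega> in M. stopped T p \<tau> \<omega> + stopped T R \<tau> \<omega> = y \<omega>" by simp
      then show "AE \<omega> in M. (\<forall>t\<le>T. p t \<omega> + R t \<omega> \<le> y \<omega>) \<and>
         stopped T p \<tau> \<omega> + stopped T R \<tau> \<omega> = y \<omega>"
        using d by (auto simp: DOS_feasible_def)
    next
      assume ae: "AE \<omega> in M. (\<forall>t\<le>T. p t \<omega> + R t \<omega> \<le> y \<omega>) \<and>
         stopped T p \<tau> \<omega> + stopped T R \<tau> \<omega> = y \<omega>"
      then have d: "(p, y) \<in> DOS_feasible M T F R X V Y"
        using p y by (auto simp: DOS_feasible_def)
      with ae eq_iff[OF \<tau> d] have "OS_value M T R \<tau> = DOS_value M (p, y)" by auto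
      note solves_if_values_eq(1,2)[of \<tau> "stopping_times M T F" "(p, y)" "DOS_feasible M T F R X V Y"
        "OS_value M T R" "DOS_value M", OF \<tau> d this fin weak']
      then show "solves_max (stopping_times M T F) (OS_value M T R) \<tau> \<and>
        solves_min (DOS_feasible M T F R X V Y) (DOS_value M) (p, y)" by blast
    }
  qed
qed

end
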